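(* Let $A=\{a^1,\dots,a^m\}\subset\mathbb R^n$ be a data set and let $k$ be a positive integer with $k\le m$. If the data points $a^1,\dots,a^m$ are pairwise distinct, then the centroids $\bar x^1,\dots,\bar x^k$ of the centroid system $\bar x=(\bar x^1,\dots,\bar x^k)$ obtained by Algorithm 2 (described in the context) applied to $A$ and $k$ are pairwise distinct.
   Context: $\mathbb R^n$ carries the Euclidean norm $\|\cdot\|$; $I=\{1,\dots,m\}$; $|\Omega|$ is the number of elements of a finite set $\Omega$. A vector $x=(x^1,\dots,x^r)\in\mathbb R^{n\times r}$ with $x^j\in\mathbb R^n$ is called a centroid system, and for $r\ge1$ $$f_r(x)=\frac1m\sum_{i=1}^m\Big(\min_{j=1,\dots,r}\|a^i-x^j\|^2\Big),\qquad x=(x^1,\dots,x^r)\in\mathbb R^{n\times r}.$$ **The $k$-means algorithm (KM) with $r$ centroids**, with a tolerance $\varepsilon\ge0$, started at an initial centroid system $(x^1,\dots,x^r)$: repeat the following. (i) Form the natural clustering: $A^0=\emptyset$ and, inductively for $j=1,\dots,r$, $$A^j=\Big\{a^i\in A\setminus\bigcup_{p=0}^{j-1}A^p\ \Big|\ \|a^i-x^j\|=\min_{q=1,\dots,r}\|a^i-x^q\|\Big\}.$$ (ii) For each $j$ with $A^j\ne\emptyset$ put $\widetilde x^j=\frac1{|I(A^j)|}\sum_{i\in I(A^j)}a^i$, where $I(A^j)=\{i\in I\mid a^i\in A^j\}$; for each $j$ with $A^j=\emptyset$ put $\widetilde x^j=x^j$. Replace $x^j$ by $\widetilde x^j$ for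 all $j$. (iii) If in this iteration $\|\widetilde x^j-x^j\|\le\varepsilon$ for all $j$ with $A^j\neq\emptyset$, stop and output the current centroid system; otherwise go to (i). **Procedure 2.** Input: a centroid system $\bar x=(\bar x^1,\dots,\bar x^\ell)$ with $1\le\ell\le k-1$. Define $d_\ell(a^i)=\min\{\|\bar x^1-a^i\|^2,\dots,\|\bar x^\ell-a^i\|^2\}$ for $i\in I$, $$Y_1=\{y\in\mathbb R^n\mid\exists i\in I\text{ with }\|y-a^i\|^2<d_\ell(a^i)\},$$ $A_1(y)=\{a^i\in A\mid\|y-a^i\|^2<d_\ell(a^i)\}$ for $y\in Y_1$, and $$z_{\ell+1}(y)=\frac1m\sum_{i\in I}\max\{0,\,d_\ell(a^i)-\|y-a^i\|^2\}\qquad(y\in\mathbb R^n).$$ Step 1. Select control parameters $\gamma_1\in[0,1]$, $\gamma_2\in[0,1]$, $\gamma_3\in[1,\infty)$. Step 2. Compute $z^1_{\max}=\max\{z_{\ell+1}(a)\mid a\in A\cap Y_1\}$ and $\bar A_1=\{a\in A\cap Y_1\mid z_{\ell+1}(a)\ge\gamma_1z^1_{\max}\}$. Step 3. For each $a\in\bar A_1$ let $c(a)$ be the barycenter (arithmetic mean) of the set $A_1(a)$. Put $\bar A_2=\{c(a)\mid a\in\bar A_1\}$, $z^2_{\max}=\max\{z_{\ell+1}(c)\mid c\in\bar A_2\}$, and $\bar A_3=\{c\in\bar A_2\mid z_{\ell+1}(c)\ge\gamma_2z^2_{\max}\}$. Step 4. Form $\Omega=\{(\bar x^1,\dots,\bar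 x^\ell,c)\mid c\in\bar A_3\}$. Step 5. Apply KM with $\ell+1$ centroids from each initial centroid system $(\bar x^1,\dots,\bar x^\ell,c)\in\Omega$; let $\widetilde A_4\subset\mathbb R^{n\times(\ell+1)}$ be the set of the resulting centroid systems. Step 6. Compute $\widetilde f^{\min}_{\ell+1}=\min\{f_{\ell+1}(x)\mid x\in\widetilde A_4\}$ and $\widetilde A_5=\{x\in\widetilde A_4\mid f_{\ell+1}(x)\le\gamma_3\widetilde f^{\min}_{\ell+1}\}$. Step 7. Output an (arbitrarily picked) point $\hat x=(\hat x^1,\dots,\hat x^{\ell+1})\in\widetilde A_5$. **Algorithm 2.** Input: $n,m,k$ and $A=\{a^1,\dots,a^m\}$. Step 1. Compute the barycenter $a^0=\frac1m\sum_{i=1}^ma^i$, put $\bar x^1=a^0$, and set $\ell=1$. Step 2. If $\ell=k$, go to Step 5. Step 3. Apply Procedure 2 to $(\bar x^1,\dots,\bar x^\ell)$ to get $\hat x=(\hat x^1,\dots,\hat x^{\ell+1})$. Step 4. Put $\bar x^j:=\hat x^j$ for $j=1,\dots,\ell+1$, set $\ell:=\ell+1$, and go to Step 2. Step 5. Select an (arbitrary) element $\bar x=(\bar x^1,\dots,\bar x^k)$ from the set $\widetilde A_6:=\{x\in\widetilde A_5\mid f_k(x)=\widetilde f^{\min}_k\}$, where $\widetilde A_5$ and $\widetilde f^{\min}_k$ are those computed in the last run of Procedure 2 (the run that produced systems of $k$ centroids). If $k=1$, Procedure 2 is never run and the output is $\bar x=(a^0)$. Output $\bar x$ (together with the natural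 clustering associated with $\bar x$). *)

theory Defs
  imports "HOL-Analysis.Analysis"
begin

text \<open>
  The data points are \<open>a 1, \<dots>, a m\<close>.  A centroid system with \<open>r\<close> centroids is a list of
  length \<open>r\<close>; the centroid with (one-based) index \<open>j\<close> is the list entry \<open>x ! (j - 1)\<close>, and a
  minimum over \<open>j = 1, \<dots>, r\<close> is written as a minimum over \<open>set x\<close>.
\<close>

definition data_set :: "nat \<Rightarrow> (nat \<Rightarrow> real ^ 'n) \<Rightarrow> (real ^ 'n) set" where
  "data_set m a = a ` {1..m}"

definition barycenter :: "(real ^ 'n) set \<Rightarrow> real ^ 'n" where
  "barycenter S = (1 / real (card S)) *\<^sub>R (\<Sum>p\<in>S. p)"

definition min_sq_dist :: "(real ^ 'n) list \<Rightarrow> real ^ 'n \<Rightarrow> real" where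
  "min_sq_dist x p = Min ((\<lambda>c. (norm (p - c))\<^sup>2) ` set x)"

definition objective :: "nat \<Rightarrow> (nat \<Rightarrow> real ^ 'n) \<Rightarrow> (real ^ 'n) list \<Rightarrow> real" where
  "objective m a x = (1 / real m) * (\<Sum>i=1..m. min_sq_dist x (a i))"


subsection \<open>The k-means algorithm\<close>

text \<open>Clusters carry one-based indices: cluster \<open>Suc j\<close> belongs to the centroid \<open>x ! j\<close>.\<close>

fun natural_cluster :: "(real ^ 'n) set \<Rightarrow> (real ^ 'n) list \<Rightarrow> nat \<Rightarrow> (real ^ 'n) set" where
  "natural_cluster A x 0 = {}"
| "natural_cluster A x (Suc j) =
     {p \<in> A - (\<Union>q\<in>{0..j}. natural_cluster A x q).
        norm (p - x ! j) = Min ((\<lambda>c. norm (p - c)) ` set x)}"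

definition cluster_indices ::
    "nat \<Rightarrow> (nat \<Rightarrow> real ^ 'n) \<Rightarrow> (real ^ 'n) list \<Rightarrow> nat \<Rightarrow> nat set" where
  "cluster_indices m a x j = {i \<in> {1..m}. a i \<in> natural_cluster (data_set m a) x j}"

definition km_update :: "nat \<Rightarrow> (nat \<Rightarrow> real ^ 'n) \<Rightarrow> (real ^ 'n) list \<Rightarrow> (real ^ 'n) list" where
  "km_update m a x =
     map (\<lambda>j. if natural_cluster (data_set m a) x (Suc j) = {} then x ! j
              else (1 / real (card (cluster_indices m a x (Suc j)))) *\<^sub>R
                     (\<Sum>i\<in>cluster_indices m a x (Suc j). a i))
         [0..<length x]"

definition km_stop :: "real \<Rightarrow> nat \<Rightarrow> (nat \<Rightarrow> real ^ 'n) \<Rightarrow> (real ^ 'n) list \<Rightarrow> bool" where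
  "km_stop \<epsilon> m a x \<longleftrightarrow>
     (\<forall>j<length x. natural_cluster (data_set m a) x (Suc j) \<noteq> {} \<longrightarrow>
        norm (km_update m a x ! j - x ! j) \<le> \<epsilon>)"

text \<open>\<open>km_output \<epsilon> m a x y\<close>: started at \<open>x\<close>, the algorithm stops after finitely many iterations
  and outputs \<open>y\<close>.  The stopping test comes after the replacement, so the output is the
  updated system.\<close>

inductive km_output ::
    "real \<Rightarrow> nat \<Rightarrow> (nat \<Rightarrow> real ^ 'n) \<Rightarrow> (real ^ 'n) list \<Rightarrow> (real ^ 'n) list \<Rightarrow> bool"
  for \<epsilon> m a where
  stop: "km_stop \<epsilon> m a x \<Longrightarrow> km_output \<epsilon> m a x (km_update m a x)"
| continue: "\<not> km_stop \<epsilon> m a x \<Longrightarrow> km_output \<epsilon> m a (km_update m a x) y \<Longrightarrow> km_output \<epsilon> m a x y"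


subsection \<open>Procedure 2\<close>

definition Y1 :: "nat \<Rightarrow> (nat \<Rightarrow> real ^ 'n) \<Rightarrow> (real ^ 'n) list \<Rightarrow> (real ^ 'n) set" where
  "Y1 m a x = {y. \<exists>i\<in>{1..m}. (norm (y - a i))\<^sup>2 < min_sq_dist x (a i)}"

definition A1 :: "nat \<Rightarrow> (nat \<Rightarrow> real ^ 'n) \<Rightarrow> (real ^ 'n) list \<Rightarrow> real ^ 'n \<Rightarrow> (real ^ 'n) set" where
  "A1 m a x y = {p \<in> data_set m a. (norm (y - p))\<^sup>2 < min_sq_dist x p}"

definition z_fun :: "nat \<Rightarrow> (nat \<Rightarrow> real ^ 'n) \<Rightarrow> (real ^ 'n) list \<Rightarrow> real ^ 'n \<Rightarrow> real" where
  "z_fun m a x y =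
     (1 / real m) * (\<Sum>i=1..m. max 0 (min_sq_dist x (a i) - (norm (y - a i))\<^sup>2))"

definition z1_max :: "nat \<Rightarrow> (nat \<Rightarrow> real ^ 'n) \<Rightarrow> (real ^ 'n) list \<Rightarrow> real" where
  "z1_max m a x = Max (z_fun m a x ` (data_set m a \<inter> Y1 m a x))"

definition A1_bar ::
    "real \<Rightarrow> nat \<Rightarrow> (nat \<Rightarrow> real ^ 'n) \<Rightarrow> (real ^ 'n) list \<Rightarrow> (real ^ 'n) set" where
  "A1_bar \<gamma>1 m a x =
     {p \<in> data_set m a \<inter> Y1 m a x. z_fun m a x p \<ge> \<gamma>1 * z1_max m a x}"

definition A2_bar ::
    "real \<Rightarrow> nat \<Rightarrow> (nat \<Rightarrow> real ^ 'n) \<Rightarrow> (real ^ 'n) list \<Rightarrow> (real ^ 'n) set" where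
  "A2_bar \<gamma>1 m a x = (\<lambda>p. barycenter (A1 m a x p)) ` A1_bar \<gamma>1 m a x"

definition z2_max :: "real \<Rightarrow> nat \<Rightarrow> (nat \<Rightarrow> real ^ 'n) \<Rightarrow> (real ^ 'n) list \<Rightarrow> real" where
  "z2_max \<gamma>1 m a x = Max (z_fun m a x ` A2_bar \<gamma>1 m a x)"

definition A3_bar ::
    "real \<Rightarrow> real \<Rightarrow> nat \<Rightarrow> (nat \<Rightarrow> real ^ 'n) \<Rightarrow> (real ^ 'n) list \<Rightarrow> (real ^ 'n) set" where
  "A3_bar \<gamma>1 \<gamma>2 m a x =
     {c \<in> A2_bar \<gamma>1 m a x. z_fun m a x c \<ge> \<gamma>2 * z2_max \<gamma>1 m a x}"

definition Omega_set ::
    "real \<Rightarrow> real \<Rightarrow> nat \<Rightarrow> (nat \<Rightarrow> real ^ 'n) \<Rightarrow> (real ^ 'n) list \<Rightarrow> (real ^ 'n) list set" where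
  "Omega_set \<gamma>1 \<gamma>2 m a x = (\<lambda>c. x @ [c]) ` A3_bar \<gamma>1 \<gamma>2 m a x"

definition A4_tilde ::
    "real \<Rightarrow> real \<Rightarrow> real \<Rightarrow> nat \<Rightarrow> (nat \<Rightarrow> real ^ 'n) \<Rightarrow> (real ^ 'n) list
      \<Rightarrow> (real ^ 'n) list set" where
  "A4_tilde \<epsilon> \<gamma>1 \<gamma>2 m a x = {y. \<exists>w\<in>Omega_set \<gamma>1 \<gamma>2 m a x. km_output \<epsilon> m a w y}"

definition f_min ::
    "real \<Rightarrow> real \<Rightarrow> real \<Rightarrow> nat \<Rightarrow> (nat \<Rightarrow> real ^ 'n) \<Rightarrow> (real ^ 'n) list \<Rightarrow> real" where
  "f_min \<epsilon> \<gamma>1 \<gamma>2 m a x = Min (objective m a ` A4_tilde \<epsilon> \<gamma>1 \<gamma>2 m a x)"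

definition A5_tilde ::
    "real \<Rightarrow> real \<Rightarrow> real \<Rightarrow> real \<Rightarrow> nat \<Rightarrow> (nat \<Rightarrow> real ^ 'n) \<Rightarrow> (real ^ 'n) list
      \<Rightarrow> (real ^ 'n) list set" where
  "A5_tilde \<epsilon> \<gamma>1 \<gamma>2 \<gamma>3 m a x =
     {y \<in> A4_tilde \<epsilon> \<gamma>1 \<gamma>2 m a x. objective m a y \<le> \<gamma>3 * f_min \<epsilon> \<gamma>1 \<gamma>2 m a x}"

definition A6_tilde ::
    "real \<Rightarrow> real \<Rightarrow> real \<Rightarrow> real \<Rightarrow> nat \<Rightarrow> (nat \<Rightarrow> real ^ 'n) \<Rightarrow> (real ^ 'n) list
      \<Rightarrow> (real ^ 'n) list set" where
  "A6_tilde \<epsilon> \<gamma>1 \<gamma>2 \<gamma>3 m a x =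
     {y \<in> A5_tilde \<epsilon> \<gamma>1 \<gamma>2 \<gamma>3 m a x. objective m a y = f_min \<epsilon> \<gamma>1 \<gamma>2 m a x}"


subsection \<open>Algorithm 2\<close>

definition data_mean :: "nat \<Rightarrow> (nat \<Rightarrow> real ^ 'n) \<Rightarrow> real ^ 'n" where
  "data_mean m a = (1 / real m) *\<^sub>R (\<Sum>i=1..m. a i)"

text \<open>
  The control parameters are selected anew in each run of Procedure 2; \<open>\<gamma>1 l\<close>, \<open>\<gamma>2 l\<close>, \<open>\<gamma>3 l\<close> are
  those of the run whose input has \<open>l\<close> centroids.  \<open>alg2_reaches\<close> holds of the systems that can
  be current in some execution of the loop, for some sequence of the arbitrary picks made by
  Procedure 2; the loop counter is the length of the list.
\<close>

inductive alg2_reaches ::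
    "real \<Rightarrow> (nat \<Rightarrow> real) \<Rightarrow> (nat \<Rightarrow> real) \<Rightarrow> (nat \<Rightarrow> real) \<Rightarrow> nat \<Rightarrow> (nat \<Rightarrow> real ^ 'n) \<Rightarrow> nat
      \<Rightarrow> (real ^ 'n) list \<Rightarrow> bool"
  for \<epsilon> \<gamma>1 \<gamma>2 \<gamma>3 m a k where
  init: "alg2_reaches \<epsilon> \<gamma>1 \<gamma>2 \<gamma>3 m a k [data_mean m a]"
| step: "alg2_reaches \<epsilon> \<gamma>1 \<gamma>2 \<gamma>3 m a k x \<Longrightarrow> l = length x \<Longrightarrow> l \<noteq> k \<Longrightarrow>
         y \<in> A5_tilde \<epsilon> (\<gamma>1 l) (\<gamma>2 l) (\<gamma>3 l) m a x \<Longrightarrow>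
         alg2_reaches \<epsilon> \<gamma>1 \<gamma>2 \<gamma>3 m a k y"

text \<open>For \<open>k > 1\<close> the last run of Procedure 2 is the one whose input \<open>x\<close> has \<open>k - 1\<close> centroids.\<close>

inductive alg2_output ::
    "real \<Rightarrow> (nat \<Rightarrow> real) \<Rightarrow> (nat \<Rightarrow> real) \<Rightarrow> (nat \<Rightarrow> real) \<Rightarrow> nat \<Rightarrow> (nat \<Rightarrow> real ^ 'n) \<Rightarrow> nat
      \<Rightarrow> (real ^ 'n) list \<Rightarrow> bool"
  for \<epsilon> \<gamma>1 \<gamma>2 \<gamma>3 m a k where
  single: "k = 1 \<Longrightarrow> alg2_output \<epsilon> \<gamma>1 \<gamma>2 \<gamma>3 m a k [data_mean m a]"
| last_run: "alg2_reaches \<epsilon> \<gamma>1 \<gamma>2 \<gamma>3 m a k x \<Longrightarrow> l = length x \<Longrightarrow> Suc l = k \<Longrightarrow>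
             y \<in> A6_tilde \<epsilon> (\<gamma>1 l) (\<gamma>2 l) (\<gamma>3 l) m a x \<Longrightarrow>
             alg2_output \<epsilon> \<gamma>1 \<gamma>2 \<gamma>3 m a k y"

end

(*
  A k-means step keeps pairwise distinct centroids distinct: for i < j, the updated i-th centroid
  lies in the closed half-space of points at least as close to x^i as to x^j, and the updated
  j-th one in the complementary open half-space (ties go to the smaller index). This holds
  for empty clusters too, whose centroids do not move. Procedure 2 appends a new centroid which
  is strictly closer to some data point than all the old ones, hence differs from them.
  The k-means algorithm terminates since the objective drops strictly in each non-final step
  while the centroids stay in the finite set of initial centroids and means of data subsets.
*)

theory Submission
  imports Defs
begin

section \<open>Means\<close>

text \<open>An indexed family covers both uses: cluster means over index sets, and
  \<open>barycenter\<close>, which is the mean of the identity family on a point set.\<close>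

definition mean :: "('i \<Rightarrow> 'v::real_vector) \<Rightarrow> 'i set \<Rightarrow> 'v" where
  "mean f I = (1 / real (card I)) *\<^sub>R (\<Sum>i\<in>I. f i)"

lemma mean_in_convex:
  assumes "finite I" "I \<noteq> {}" "convex S" "\<And>i. i \<in> I \<Longrightarrow> f i \<in> S"
  shows "mean f I \<in> S"
proof -
  have "(\<Sum>i\<in>I. (1 / real (card I)) *\<^sub>R f i) \<in> S"
    by (rule convex_sum) (use assms in auto)
  then show ?thesis
    by (simp add: mean_def scaleR_sum_right)
qed

text \<open>Huygens-Steiner identity: expand each square around the mean; the cross terms cancel
  because the deviations from the mean sum to zero.\<close>

lemma sum_sq_dist_mean:
  fixes f :: "'i \<Rightarrow> 'v::real_inner"
  assumes "finite I" "I \<noteq> {}"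
  shows "(\<Sum>i\<in>I. (norm (f i - u))\<^sup>2) =
    (\<Sum>i\<in>I. (norm (f i - mean f I))\<^sup>2) + real (card I) * (norm (mean f I - u))\<^sup>2"
proof -
  define \<mu> where "\<mu> = mean f I"
  have "(\<Sum>i\<in>I. f i) = real (card I) *\<^sub>R \<mu>"
    using assms by (simp add: \<mu>_def mean_def)
  then have zero: "(\<Sum>i\<in>I. f i - \<mu>) = 0"
    by (simp add: sum_subtractf sum_constant_scaleR)
  have "(norm (f i - u))\<^sup>2 =
      (norm (f i - \<mu>))\<^sup>2 + (norm (\<mu> - u))\<^sup>2 + 2 * ((f i - \<mu>) \<bullet> (\<mu> - u))" for i
    by (simp add: power2_norm_eq_inner inner_diff_left inner_diff_right inner_commute
        algebra_simps)
  then have "(\<Sum>i\<in>I. (norm (f i - u))\<^sup>2) =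
      (\<Sum>i\<in>I. (norm (f i - \<mu>))\<^sup>2) + real (card I) * (norm (\<mu> - u))\<^sup>2
        + 2 * ((\<Sum>i\<in>I. f i - \<mu>) \<bullet> (\<mu> - u))"
    by (simp add: sum.distrib sum_distrib_left inner_sum_left)
  then show ?thesis
    by (simp add: zero flip: \<mu>_def)
qed

text \<open>After squaring, the quadratic term in \<open>y\<close> cancels, which leaves a linear
  inequality; convexity then comes from half-spaces.\<close>

lemma norm_le_iff_halfspace:
  fixes y u v :: "'v::real_inner"
  shows "norm (y - u) \<le> norm (y - v) \<longleftrightarrow> (2 *\<^sub>R (v - u)) \<bullet> y \<le> v \<bullet> v - u \<bullet> u"
  by (simp add: norm_le inner_diff_left inner_diff_right inner_commute algebra_simps)

lemma convex_closer: "convex {y :: 'v::real_inner. norm (y - u) \<le> norm (y - v)}"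
  unfolding norm_le_iff_halfspace by (rule convex_halfspace_le)

lemma convex_strictly_closer: "convex {y :: 'v::real_inner. norm (y - u) < norm (y - v)}"
proof -
  have "{y. norm (y - u) < norm (y - v)} = {y. (2 *\<^sub>R (u - v)) \<bullet> y > u \<bullet> u - v \<bullet> v}"
    using norm_le_iff_halfspace[of _ v u] by (auto simp flip: not_le)
  then show ?thesis
    by (simp only: convex_halfspace_gt)
qed

section \<open>The k-means algorithm\<close>

text \<open>Resolves the recursion: a point goes to the first of its nearest centroids, since an
  earlier one at the same distance would have prevented it from reaching this cluster.\<close>

lemma natural_cluster_iff:
  assumes "j < length x"
  shows "p \<in> natural_cluster A x (Suc j) \<longleftrightarrow> p \<in> A \<and>
    (\<forall>i<length x. norm (p - x ! j) \<le> norm (p - x ! i)) \<and>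
    (\<forall>i<j. norm (p - x ! j) < norm (p - x ! i))"
proof -
  let ?M = "Min ((\<lambda>c. norm (p - c)) ` set x)"
  have M_iff: "norm (p - x ! i) = ?M \<longleftrightarrow> (\<forall>q<length x. norm (p - x ! i) \<le> norm (p - x ! q))"
    if "i < length x" for i
  proof
    assume "norm (p - x ! i) = ?M"
    then show "\<forall>q<length x. norm (p - x ! i) \<le> norm (p - x ! q)"
      by simp
  next
    assume "\<forall>q<length x. norm (p - x ! i) \<le> norm (p - x ! q)"
    then show "norm (p - x ! i) = ?M"
      using that by (intro Min_eqI[symmetric]) (auto simp: in_set_conv_nth intro!: image_eqI[of _ _ "x ! i"])
  qed
  show ?thesis
  proof (intro iffI conjI allI impI; (elim conjE)?)
    assume p: "p \<in> natural_cluster A x (Suc j)"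
    then show "p \<in> A" by simp
    show "norm (p - x ! j) \<le> norm (p - x ! i)" if "i < length x" for i
      using p that M_iff[OF assms] by simp
    fix i assume i: "i < j"
    have "norm (p - x ! i) \<noteq> ?M"
    proof
      assume "norm (p - x ! i) = ?M"
      \<comment> \<open>Cluster \<open>Suc i\<close> excludes only clusters
        \<open>q \<le> i\<close>, so a point attaining the minimum at \<open>x ! i\<close> is placed
        there or was taken before. As \<open>Suc i \<le> j\<close>, either case bars it from cluster
        \<open>Suc j\<close>.\<close>
      then have "p \<in> natural_cluster A x (Suc i) \<or> (\<exists>q\<le>i. p \<in> natural_cluster A x q)"
        using \<open>p \<in> A\<close> by auto
      then have "\<exists>q\<le>j. p \<in> natural_cluster A x q"
        using i by (meson Suc_leI le_trans less_imp_le)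
      then show False
        using p by auto
    qed
    moreover have "norm (p - x ! j) = ?M" and "?M \<le> norm (p - x ! i)"
      using p i assms by auto
    ultimately show "norm (p - x ! j) < norm (p - x ! i)"
      by linarith
  next
    assume p: "p \<in> A" "\<forall>i<length x. norm (p - x ! j) \<le> norm (p - x ! i)"
      and less: "\<forall>i<j. norm (p - x ! j) < norm (p - x ! i)"
    have "p \<notin> natural_cluster A x q" if "q \<le> j" for q
    proof (cases q)
      case (Suc i)
      have "?M \<le> norm (p - x ! j)"
        using assms by simp
      moreover have "norm (p - x ! j) < norm (p - x ! i)"
        using less Suc that by simp
      ultimately show ?thesis
        by (auto simp: Suc)
    qed simp
    then show "p \<in> natural_cluster A x (Suc j)"
      using p M_iff[OF assms] by auto
  qed
qed

lemma ex_natural_cluster: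
  assumes "p \<in> A" "x \<noteq> []"
  shows "\<exists>j<length x. p \<in> natural_cluster A x (Suc j)"
proof -
  have "\<exists>j. is_arg_min (\<lambda>j. norm (p - x ! j)) (\<lambda>j. j \<in> {..<length x}) j"
    using assms(2) by (intro ex_is_arg_min_if_finite) (auto simp: lessThan_empty_iff)
  then have ex: "\<exists>j. j < length x \<and> (\<forall>i<length x. norm (p - x ! j) \<le> norm (p - x ! i))"
    by (simp add: is_arg_min_linorder)
  \<comment> \<open>The least index among the nearest centroids reproduces the tie-breaking of the
    clusters.\<close>
  define j where "j = (LEAST j. j < length x \<and> (\<forall>i<length x. norm (p - x ! j) \<le> norm (p - x ! i)))"
  have j: "j < length x" "\<And>i. i < length x \<Longrightarrow> norm (p - x ! j) \<le> norm (p - x ! i)"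
    using LeastI_ex[OF ex] unfolding j_def by auto
  have "norm (p - x ! j) < norm (p - x ! i)" if "i < j" for i
  proof -
    have "\<exists>q<length x. norm (p - x ! q) < norm (p - x ! i)"
      using not_less_Least[of i, OF that[unfolded j_def]] j(1) that by (auto simp: not_le)
    then show ?thesis
      using j(2) by fastforce
  qed
  then show ?thesis
    using natural_cluster_iff[OF j(1)] j assms(1) by blast
qed

section \<open>Index sets of clusters and the update step\<close>

lemma cluster_indices_subset: "cluster_indices m a x j \<subseteq> {1..m}"
  by (auto simp: cluster_indices_def)

lemma finite_cluster_indices [simp]: "finite (cluster_indices m a x j)"
  by (rule finite_subset[OF cluster_indices_subset]) simp

lemma cluster_indices_iff:
  assumes "j < length x"
  shows "i \<in> cluster_indices m a x (Suc j) \<longleftrightarrow> i \<in> {1..m} \<and>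
    (\<forall>q<length x. norm (a i - x ! j) \<le> norm (a i - x ! q)) \<and>
    (\<forall>q<j. norm (a i - x ! j) < norm (a i - x ! q))"
  unfolding cluster_indices_def mem_Collect_eq natural_cluster_iff[OF assms]
  by (auto simp: data_set_def)

text \<open>The update tests a point set for emptiness but averages over an index set; this allows
  working with index sets alone.\<close>

lemma natural_cluster_empty_iff:
  assumes "j < length x"
  shows "natural_cluster (data_set m a) x (Suc j) = {} \<longleftrightarrow> cluster_indices m a x (Suc j) = {}"
proof -
  have "natural_cluster (data_set m a) x (Suc j) \<subseteq> a ` {1..m}"
    by (auto simp: data_set_def)
  then show ?thesis
    unfolding cluster_indices_def by blast
qed

lemma length_km_update [simp]: "length (km_update m a x) = length x"
  by (simp add: km_update_def)

lemma nth_km_update: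
  assumes "j < length x"
  shows "km_update m a x ! j =
    (if cluster_indices m a x (Suc j) = {} then x ! j else mean a (cluster_indices m a x (Suc j)))"
  using assms natural_cluster_empty_iff[OF assms, of m a]
  by (simp add: km_update_def mean_def del: natural_cluster.simps)

lemma distinct_km_update:
  assumes "distinct x"
  shows "distinct (km_update m a x)"
proof -
  let ?y = "km_update m a x"
  have "?y ! i \<noteq> ?y ! j" if ij: "i < j" "j < length x" for i j
  proof -
    have i: "i < length x" and neq: "x ! i \<noteq> x ! j"
      using ij assms by (auto simp: nth_eq_iff_index_eq)
    have "?y ! i \<in> {y. norm (y - x ! i) \<le> norm (y - x ! j)}"
    proof (cases "cluster_indices m a x (Suc i) = {}")
      case False
      show ?thesis
        unfolding nth_km_update[OF i] if_not_P[OF False]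
        by (rule mean_in_convex[OF _ False convex_closer])
          (use cluster_indices_iff[OF i] ij in auto)
    qed (simp add: nth_km_update[OF i])
    moreover have "?y ! j \<in> {y. norm (y - x ! j) < norm (y - x ! i)}"
    proof (cases "cluster_indices m a x (Suc j) = {}")
      case False
      show ?thesis
        unfolding nth_km_update[OF ij(2)] if_not_P[OF False]
        by (rule mean_in_convex[OF _ False convex_strictly_closer])
          (use cluster_indices_iff[OF ij(2)] ij in auto)
    \<comment> \<open>For an empty cluster the updated centroid is \<open>x ! j\<close> itself, so
      strictness comes from the distinctness of the old centroids.\<close>
    qed (use neq in \<open>simp add: nth_km_update[OF ij(2)]\<close>)
    ultimately show ?thesis
      by auto
  qed
  then show ?thesis
    unfolding distinct_conv_nth length_km_update by (metis linorder_neqE_nat)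
qed

section \<open>Descent of the objective\<close>

lemma min_sq_dist_le: "c \<in> set x \<Longrightarrow> min_sq_dist x p \<le> (norm (p - c))\<^sup>2"
  by (simp add: min_sq_dist_def)

lemma min_sq_dist_attained:
  assumes "x \<noteq> []"
  obtains c where "c \<in> set x" "min_sq_dist x p = (norm (p - c))\<^sup>2"
proof -
  have "min_sq_dist x p \<in> (\<lambda>c. (norm (p - c))\<^sup>2) ` set x"
    unfolding min_sq_dist_def using assms by (intro Min_in) auto
  then show ?thesis
    using that by blast
qed

text \<open>The clusters partition the indices: every point has a first nearest centroid, and
  strictness against smaller indices gives disjointness.\<close>

lemma sum_clusters:
  fixes h :: "nat \<Rightarrow> real"
  assumes "x \<noteq> []"
  shows "(\<Sum>i=1..m. h i) = (\<Sum>j<length x. \<Sum>i\<in>cluster_indices m a x (Suc j). h i)"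
proof -
  have "{1..m} = (\<Union>j<length x. cluster_indices m a x (Suc j))"
    using ex_natural_cluster[OF _ assms, of _ "data_set m a"]
    by (fastforce simp: cluster_indices_def data_set_def simp del: natural_cluster.simps)
  moreover have "cluster_indices m a x (Suc i) \<inter> cluster_indices m a x (Suc j) = {}"
    if "i < length x" "j < length x" "i \<noteq> j" for i j
    using that by (fastforce simp: cluster_indices_iff neq_iff)
  ultimately show ?thesis
    by (simp add: sum.UNION_disjoint)
qed

text \<open>With the old clusters fixed, moving centroids to cluster means lowers the total,
  strictly where the move exceeds \<open>\<epsilon>\<close>; reassigning points to nearest centroids
  can only lower it further.\<close>

lemma objective_km_update_less:
  assumes "x \<noteq> []" "m \<noteq> 0" "\<epsilon> \<ge> 0" "\<not> km_stop \<epsilon> m a x"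
  shows "objective m a (km_update m a x) < objective m a x"
proof -
  let ?I = "\<lambda>j. cluster_indices m a x (Suc j)" and ?y = "km_update m a x"
  obtain j0 where j0: "j0 < length x" "?I j0 \<noteq> {}" "\<epsilon> < norm (?y ! j0 - x ! j0)"
    using assms(4) natural_cluster_empty_iff unfolding km_stop_def
    by (metis not_le)
  have split: "(\<Sum>i\<in>?I j. (norm (a i - x ! j))\<^sup>2) =
      (\<Sum>i\<in>?I j. (norm (a i - ?y ! j))\<^sup>2) + real (card (?I j)) * (norm (?y ! j - x ! j))\<^sup>2"
    if "j < length x" for j
    using sum_sq_dist_mean[of "?I j" a "x ! j"] that by (auto simp: nth_km_update)
  have "(\<Sum>i=1..m. min_sq_dist ?y (a i)) = (\<Sum>j<length x. \<Sum>i\<in>?I j. min_sq_dist ?y (a i))"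
    by (rule sum_clusters[OF assms(1)])
  also have "\<dots> \<le> (\<Sum>j<length x. \<Sum>i\<in>?I j. (norm (a i - ?y ! j))\<^sup>2)"
    by (intro sum_mono min_sq_dist_le) simp
  also have "\<dots> < (\<Sum>j<length x. \<Sum>i\<in>?I j. (norm (a i - x ! j))\<^sup>2)"
  proof (rule sum_strict_mono_ex1)
    have "0 < real (card (?I j0)) * (norm (?y ! j0 - x ! j0))\<^sup>2"
      using j0 assms(3) by (intro mult_pos_pos) (auto simp: card_gt_0_iff)
    then show "\<exists>j\<in>{..<length x}. (\<Sum>i\<in>?I j. (norm (a i - ?y ! j))\<^sup>2)
        < (\<Sum>i\<in>?I j. (norm (a i - x ! j))\<^sup>2)"
      using j0(1) split by (intro bexI[of _ j0]) auto
  qed (simp_all add: split)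
  \<comment> \<open>The old centroid of its own cluster is a nearest one for each point.\<close>
  also have "\<dots> = (\<Sum>j<length x. \<Sum>i\<in>?I j. min_sq_dist x (a i))"
  proof (intro sum.cong refl)
    fix j i assume j: "j \<in> {..<length x}" and i: "i \<in> ?I j"
    show "(norm (a i - x ! j))\<^sup>2 = min_sq_dist x (a i)"
      unfolding min_sq_dist_def using i j
      by (intro Min_eqI[symmetric]) (auto simp: cluster_indices_iff in_set_conv_nth intro!: image_eqI[of _ _ "x ! j"])
  qed
  also have "\<dots> = (\<Sum>i=1..m. min_sq_dist x (a i))"
    by (rule sum_clusters[OF assms(1), symmetric])
  finally show ?thesis
    using assms(2) by (simp add: objective_def divide_strict_right_mono)
qed

section \<open>Termination and determinism of the iteration\<close>

lemma km_output_exists: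
  assumes "x \<noteq> []" "m \<noteq> 0" "\<epsilon> \<ge> 0"
  shows "\<exists>y. km_output \<epsilon> m a x y"
proof -
  \<comment> \<open>Contains every centroid that can occur: an empty cluster keeps its centroid, any
    other gets the mean of a subset of the data.\<close>
  define F where "F = set x \<union> mean a ` Pow {1..m}"
  define L where "L = {u. set u \<subseteq> F \<and> length u = length x}"
  have "finite L"
    unfolding L_def by (rule finite_lists_length_eq) (simp add: F_def)
  have upd: "km_update m a u \<in> L" if "u \<in> L" for u
  proof -
    have "km_update m a u ! j \<in> F" if "j < length u" for j
    proof (cases "cluster_indices m a u (Suc j) = {}")
      case True
      then show ?thesis
        using that \<open>u \<in> L\<close> by (simp add: nth_km_update L_def subset_iff)
    next
      case False
      then show ?thesis
        using that cluster_indices_subset[of m a u "Suc j"] by (simp add: nth_km_update F_def)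
    qed
    then have "set (km_update m a u) \<subseteq> F"
      by (metis in_set_conv_nth length_km_update subsetI)
    then show ?thesis
      using that by (simp add: L_def)
  qed
  have "\<exists>y. km_output \<epsilon> m a u y" if "u \<in> L" for u
    using that
  proof (induction "card {v \<in> L. objective m a v < objective m a u}" arbitrary: u
      rule: less_induct)
    case less
    show ?case
    proof (cases "km_stop \<epsilon> m a u")
      case True
      then show ?thesis by (blast intro: km_output.stop)
    next
      case False
      have "u \<noteq> []"
        using less.prems assms(1) by (auto simp: L_def)
      then have "objective m a (km_update m a u) < objective m a u"
        using objective_km_update_less assms(2,3) False by blast
      \<comment> \<open>The inclusion is proper: the updated system belongs to the right-hand set
        but not to the left-hand one.\<close>
      then have "{v \<in> L. objective m a v < objective m a (km_update m a u)}
          \<subset> {v \<in> L. objective m a v < objective m a u}"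
        using upd[OF less.prems] by fastforce
      then have "card {v \<in> L. objective m a v < objective m a (km_update m a u)}
          < card {v \<in> L. objective m a v < objective m a u}"
        using \<open>finite L\<close> by (intro psubset_card_mono) auto
      then show ?thesis
        using less.hyps upd[OF less.prems] False by (blast intro: km_output.continue)
    qed
  qed
  then show ?thesis
    by (simp add: L_def F_def)
qed

text \<open>Needed for the finiteness of \<open>A4_tilde\<close>, so that the minimum in
  \<open>f_min\<close> is attained.\<close>

lemma km_output_deterministic:
  assumes "km_output \<epsilon> m a x y" "km_output \<epsilon> m a x y'"
  shows "y = y'"
  using assms
proof (induction arbitrary: y' rule: km_output.induct)
  case (stop x)
  from stop(2) show ?case
    by cases (use stop(1) in auto)
next
  case (continue x y)
  from continue(4) show ?case
    by cases (use continue(1,3) in auto)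
qed

lemma km_output_preserves:
  assumes "km_output \<epsilon> m a x y" "distinct x"
  shows "distinct y \<and> length y = length x"
  using assms by induction (auto simp: distinct_km_update)

section \<open>Procedure 2\<close>

lemma z_fun_nonneg: "0 \<le> z_fun m a x y"
  by (simp add: z_fun_def sum_nonneg)

text \<open>The barycenter of \<open>A1 m a x y\<close> serves these points in total no worse than \<open>y\<close> does, and
  \<open>y\<close> serves each of them strictly better than the old centroids.\<close>

lemma barycenter_A1_notin:
  assumes "y \<in> Y1 m a x"
  shows "barycenter (A1 m a x y) \<notin> set x"
proof
  let ?S = "A1 m a x y"
  let ?c = "barycenter ?S"
  assume c: "?c \<in> set x"
  have fin: "finite ?S"
    by (simp add: A1_def data_set_def)
  have ne: "?S \<noteq> {}"
    using assms by (auto simp: A1_def Y1_def data_set_def)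
  have "?c = mean (\<lambda>p. p) ?S"
    by (simp add: barycenter_def mean_def)
  then have "(\<Sum>p\<in>?S. (norm (p - ?c))\<^sup>2) \<le> (\<Sum>p\<in>?S. (norm (p - y))\<^sup>2)"
    using sum_sq_dist_mean[OF fin ne, of "\<lambda>p. p" y] by simp
  also have "\<dots> < (\<Sum>p\<in>?S. min_sq_dist x p)"
    by (intro sum_strict_mono fin ne) (auto simp: A1_def norm_minus_commute)
  \<comment> \<open>Here the barycenter counts as an old centroid, which closes the contradictory
    chain.\<close>
  also have "\<dots> \<le> (\<Sum>p\<in>?S. (norm (p - ?c))\<^sup>2)"
    by (intro sum_mono min_sq_dist_le c)
  finally show False by simp
qed

lemma A4_tilde_preserves:
  assumes "distinct x" "y \<in> A4_tilde \<epsilon> \<gamma>1 \<gamma>2 m a x"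
  shows "distinct y \<and> length y = Suc (length x)"
proof -
  obtain p where "p \<in> Y1 m a x" "km_output \<epsilon> m a (x @ [barycenter (A1 m a x p)]) y"
    using assms(2)
    by (auto simp: A4_tilde_def Omega_set_def A3_bar_def A2_bar_def A1_bar_def)
  then show ?thesis
    using km_output_preserves barycenter_A1_notin assms(1) by fastforce
qed

text \<open>With more distinct data points than centroids, some data point is no centroid; its
  distance to all of them is positive, and to itself zero.\<close>

lemma Y1_data_nonempty:
  assumes "inj_on a {1..m}" "length x < m" "x \<noteq> []"
  shows "data_set m a \<inter> Y1 m a x \<noteq> {}"
proof -
  have "card (set x) < card (data_set m a)"
    using assms(1,2) card_length[of x] by (simp add: data_set_def card_image)
  then obtain p where p: "p \<in> data_set m a" "p \<notin> set x"
    by (metis List.finite_set card_mono linorder_not_le subsetI)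
  obtain c where "c \<in> set x" "min_sq_dist x p = (norm (p - c))\<^sup>2"
    using min_sq_dist_attained[OF assms(3)] .
  then have "0 < min_sq_dist x p"
    using p(2) by auto
  then have "p \<in> Y1 m a x"
    using p(1) by (auto simp: Y1_def data_set_def intro!: bexI)
  then show ?thesis
    using p(1) by blast
qed

text \<open>\<open>Max\<close> and \<open>Min\<close> have their intended meaning only on finite
  nonempty sets, so both properties are carried through the selection stages.\<close>

lemma A4_tilde_finite_nonempty:
  assumes "inj_on a {1..m}" "length x < m" "x \<noteq> []" "\<epsilon> \<ge> 0" "\<gamma>1 \<le> 1" "\<gamma>2 \<le> 1"
  shows "finite (A4_tilde \<epsilon> \<gamma>1 \<gamma>2 m a x)" "A4_tilde \<epsilon> \<gamma>1 \<gamma>2 m a x \<noteq> {}"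
proof -
  \<comment> \<open>Common to both selections: as \<open>z_fun\<close> is nonnegative and
    \<open>t \<le> 1\<close>, a maximiser passes the threshold.\<close>
  have nonempty: "{q \<in> S. t * Max (z_fun m a x ` S) \<le> z_fun m a x q} \<noteq> {}"
    if S: "finite S" "S \<noteq> {}" and t: "t \<le> 1" for S t
  proof -
    have "Max (z_fun m a x ` S) \<in> z_fun m a x ` S"
      using S by (intro Max_in) auto
    then obtain q where q: "q \<in> S" "Max (z_fun m a x ` S) = z_fun m a x q"
      by blast
    have "t * z_fun m a x q \<le> 1 * z_fun m a x q"
      by (rule mult_right_mono[OF t z_fun_nonneg])
    then show ?thesis using q by auto
  qed
  have fin0: "finite (data_set m a \<inter> Y1 m a x)"
    by (simp add: data_set_def)
  have "A1_bar \<gamma>1 m a x \<noteq> {}"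
    unfolding A1_bar_def z1_max_def
    by (rule nonempty[OF fin0 Y1_data_nonempty[OF assms(1-3)] assms(5)])
  moreover have "finite (A1_bar \<gamma>1 m a x)"
    by (rule finite_subset[OF _ fin0]) (auto simp: A1_bar_def)
  ultimately have "A3_bar \<gamma>1 \<gamma>2 m a x \<noteq> {}" and "finite (A3_bar \<gamma>1 \<gamma>2 m a x)"
    unfolding A3_bar_def z2_max_def
    using nonempty[of "A2_bar \<gamma>1 m a x" \<gamma>2] assms(6) by (auto simp: A2_bar_def)
  then have ne: "Omega_set \<gamma>1 \<gamma>2 m a x \<noteq> {}" and fin: "finite (Omega_set \<gamma>1 \<gamma>2 m a x)"
    by (auto simp: Omega_set_def)
  have "w \<noteq> []" if "w \<in> Omega_set \<gamma>1 \<gamma>2 m a x" for w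
    using that by (auto simp: Omega_set_def)
  then have "\<exists>y. km_output \<epsilon> m a w y" if "w \<in> Omega_set \<gamma>1 \<gamma>2 m a x" for w
    using km_output_exists[of w m \<epsilon> a] assms(2,4) that by auto
  then show "A4_tilde \<epsilon> \<gamma>1 \<gamma>2 m a x \<noteq> {}"
    using ne unfolding A4_tilde_def by blast
  \<comment> \<open>By determinism each starting system contributes at most one output.\<close>
  have "A4_tilde \<epsilon> \<gamma>1 \<gamma>2 m a x \<subseteq> (\<lambda>w. THE y. km_output \<epsilon> m a w y) ` Omega_set \<gamma>1 \<gamma>2 m a x"
  proof
    fix y assume "y \<in> A4_tilde \<epsilon> \<gamma>1 \<gamma>2 m a x"
    then obtain w where w: "w \<in> Omega_set \<gamma>1 \<gamma>2 m a x" "km_output \<epsilon> m a w y"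
      by (auto simp: A4_tilde_def)
    then have "(THE y. km_output \<epsilon> m a w y) = y"
      using km_output_deterministic by blast
    then show "y \<in> (\<lambda>w. THE y. km_output \<epsilon> m a w y) ` Omega_set \<gamma>1 \<gamma>2 m a x"
      using w(1) by force
  qed
  then show "finite (A4_tilde \<epsilon> \<gamma>1 \<gamma>2 m a x)"
    using fin finite_surj by blast
qed

lemma objective_nonneg: "x \<noteq> [] \<Longrightarrow> 0 \<le> objective m a x"
  unfolding objective_def
  by (intro mult_nonneg_nonneg sum_nonneg) (simp_all add: min_sq_dist_def)

text \<open>A minimiser of the objective over \<open>A4_tilde\<close> survives the cut to
  \<open>A5_tilde\<close>, because the objective is nonnegative and
  \<open>\<gamma>3 \<ge> 1\<close>.\<close>

lemma A6_tilde_nonempty: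
  assumes "inj_on a {1..m}" "length x < m" "x \<noteq> []" "distinct x" "\<epsilon> \<ge> 0"
    and "\<gamma>1 \<le> 1" "\<gamma>2 \<le> 1" "\<gamma>3 \<ge> 1"
  shows "A6_tilde \<epsilon> \<gamma>1 \<gamma>2 \<gamma>3 m a x \<noteq> {}"
proof -
  have "f_min \<epsilon> \<gamma>1 \<gamma>2 m a x \<in> objective m a ` A4_tilde \<epsilon> \<gamma>1 \<gamma>2 m a x"
    unfolding f_min_def
    using A4_tilde_finite_nonempty[OF assms(1-3,5-7)] by (intro Min_in) auto
  then obtain y where y: "y \<in> A4_tilde \<epsilon> \<gamma>1 \<gamma>2 m a x" "f_min \<epsilon> \<gamma>1 \<gamma>2 m a x = objective m a y"
    by blast
  have "y \<noteq> []"
    using A4_tilde_preserves[OF assms(4) y(1)] by auto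
  then have "1 * objective m a y \<le> \<gamma>3 * objective m a y"
    by (intro mult_right_mono assms(8) objective_nonneg)
  then show ?thesis
    using y by (auto simp: A6_tilde_def A5_tilde_def intro!: exI[of _ y])
qed

section \<open>Algorithm 2\<close>

lemma alg2_reaches_invariant:
  assumes "alg2_reaches \<epsilon> \<gamma>1 \<gamma>2 \<gamma>3 m a k x"
  shows "distinct x \<and> x \<noteq> []"
  using assms
proof induction
  case (step x l y)
  then show ?case
    using A4_tilde_preserves[of x y] by (fastforce simp: A5_tilde_def)
qed simp

text \<open>\<open>alg2_output\<close> is a relation that could a priori be empty; the existence
  part keeps the claim about all outputs from being vacuous.\<close>

theorem theorem3p7:
  fixes a :: "nat \<Rightarrow> real ^ 'n" and m k :: nat and \<epsilon> :: real and \<gamma>1 \<gamma>2 \<gamma>3 :: "nat \<Rightarrow> real"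
  assumes "1 \<le> k" and "k \<le> m"
    and "\<epsilon> \<ge> 0"
    and "\<And>l. 1 \<le> l \<Longrightarrow> l < k \<Longrightarrow> \<gamma>1 l \<in> {0..1}"
    and "\<And>l. 1 \<le> l \<Longrightarrow> l < k \<Longrightarrow> \<gamma>2 l \<in> {0..1}"
    and "\<And>l. 1 \<le> l \<Longrightarrow> l < k \<Longrightarrow> \<gamma>3 l \<in> {1..}"
    and "inj_on a {1..m}"
  shows "(\<exists>x. alg2_output \<epsilon> \<gamma>1 \<gamma>2 \<gamma>3 m a k x) \<and>
         (\<forall>x. alg2_output \<epsilon> \<gamma>1 \<gamma>2 \<gamma>3 m a k x \<longrightarrow> length x = k \<and> distinct x)"
proof (intro conjI allI impI)
  have A6: "A6_tilde \<epsilon> (\<gamma>1 (length x)) (\<gamma>2 (length x)) (\<gamma>3 (length x)) m a x \<noteq> {}"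
    if "alg2_reaches \<epsilon> \<gamma>1 \<gamma>2 \<gamma>3 m a k x" "length x < k" for x
  proof -
    have x: "distinct x" "x \<noteq> []" "1 \<le> length x"
      using alg2_reaches_invariant[OF that(1)] by (auto simp: Suc_le_eq)
    show ?thesis
      by (rule A6_tilde_nonempty)
        (use x that(2) assms(2,3,7) assms(4-6)[OF x(3) that(2)] in auto)
  qed
  \<comment> \<open>The loop never gets stuck before \<open>k\<close> centroids are reached.\<close>
  have reach: "\<exists>x. alg2_reaches \<epsilon> \<gamma>1 \<gamma>2 \<gamma>3 m a k x \<and> length x = l" if "1 \<le> l" "l \<le> k" for l
    using that
  proof (induction l rule: dec_induct)
    case base
    show ?case
      using alg2_reaches.init by fastforce
  next
    case (step l)
    then obtain x where x: "alg2_reaches \<epsilon> \<gamma>1 \<gamma>2 \<gamma>3 m a k x" "length x = l"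
      by auto
    \<comment> \<open>\<open>A6_tilde\<close> is contained in \<open>A5_tilde\<close>, so a
      minimiser is an admissible pick for continuing.\<close>
    then obtain y where y: "y \<in> A5_tilde \<epsilon> (\<gamma>1 l) (\<gamma>2 l) (\<gamma>3 l) m a x"
      using A6[of x] step.prems by (auto simp: A6_tilde_def)
    have "alg2_reaches \<epsilon> \<gamma>1 \<gamma>2 \<gamma>3 m a k y"
      using alg2_reaches.step[OF x(1) x(2)[symmetric] _ y] step.prems by simp
    moreover have "length y = Suc l"
      using A4_tilde_preserves y x alg2_reaches_invariant unfolding A5_tilde_def by blast
    ultimately show ?case
      by blast
  qed
  show "\<exists>x. alg2_output \<epsilon> \<gamma>1 \<gamma>2 \<gamma>3 m a k x"
  proof (cases "k = 1")
    case True
    then show ?thesis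
      by (blast intro: alg2_output.single)
  next
    case False
    then have "1 \<le> k - 1"
      using assms(1) by simp
    then obtain x where x: "alg2_reaches \<epsilon> \<gamma>1 \<gamma>2 \<gamma>3 m a k x" "length x = k - 1"
      using reach[of "k - 1"] by auto
    then show ?thesis
      using A6[of x] assms(1) by (fastforce intro: alg2_output.last_run[OF x(1) refl])
  qed
  fix x assume "alg2_output \<epsilon> \<gamma>1 \<gamma>2 \<gamma>3 m a k x"
  then have "length x = k \<and> distinct x"
  proof cases
    case (last_run w l)
    then show ?thesis
      using A4_tilde_preserves[of w x] alg2_reaches_invariant[OF last_run(1)]
      by (auto simp: A6_tilde_def A5_tilde_def)
  qed simp
  then show "length x = k" "distinct x"
    by auto
qed

end
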